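(* Let $N\ge1$. The $\mathbb{Q}$-linear map $\zeta_\ast^{\mathcal{S}}\colon(\mathfrak{A}_N^1,\ast)\to\mathbb{C}$ defined on words by $\zeta_\ast^{\mathcal{S}}(y_{s_1,\eta_1}\cdots y_{s_d,\eta_d}):=\zeta_\ast^{\mathcal{S}}\binom{s_1,\dots,s_d}{\eta_1,\dots,\eta_d}$ (with the empty word sent to $1$) is a homomorphism of algebras, i.e. $\zeta_\ast^{\mathcal{S}}(w\ast w')=\zeta_\ast^{\mathcal{S}}(w)\,\zeta_\ast^{\mathcal{S}}(w')$ for all $w,w'\in\mathfrak{A}_N^1$.
   Context: $\mathbb{N}$ denotes the positive integers, $\Gamma_N\subset\mathbb{C}$ the group of $N$th roots of unity. Colored multiple zeta values: $\zeta\binom{\mathbf{s}}{\boldsymbol\eta}:=\sum_{k_1>\cdots>k_d>0}\frac{\eta_1^{k_1}\cdots\eta_d^{k_d}}{k_1^{s_1}\cdots k_d^{s_d}}$ for $\mathbf{s}\in\mathbb{N}^d$, $\boldsymbol\eta\in\Gamma_N^d$ with $(s_1,\eta_1)\ne(1,1)$ (limit of the partial sums over $k_1\le n$). Words: $\mathfrak{A}_N^1$ is the free noncommutative polynomial algebra over $\mathbb{Q}$ on letters $y_{m,\mu}$ ($m\in\mathbb{N}$, $\mu\in\Gamma_N$); $\mathfrak{A}_N^0\subset\mathfrak{A}_N^1$ is the span of words not beginning with $y_{1,1}$; $1$ is the empty word. The stuffle product $\ast$ on $\mathfrak{A}_N^1$ is the bilinear product with $1\ast w=w\ast1=w$ and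 $y_{m,\mu}u\ast y_{n,\nu}v=y_{m,\mu}(u\ast y_{n,\nu}v)+y_{n,\nu}(y_{m,\mu}u\ast v)+y_{m+n,\mu\nu}(u\ast v)$. Regularization (known fact): the $\mathbb{Q}$-linear map $\mathfrak{A}_N^0\to\mathbb{C}$, $y_{s_1,\eta_1}\cdots y_{s_d,\eta_d}\mapsto\zeta\binom{s_1,\dots,s_d}{\eta_1,\dots,\eta_d}$, $1\mapsto1$, is an algebra homomorphism for $\ast$ and extends uniquely to an algebra homomorphism $\zeta_\ast(-;T)\colon(\mathfrak{A}_N^1,\ast)\to\mathbb{C}[T]$ with $\zeta_\ast(y_{1,1};T)=T$. Put $\zeta_\ast\big(\begin{smallmatrix}\mathbf{s}\\ \boldsymbol\eta\end{smallmatrix}\big|T\big):=\zeta_\ast(y_{s_1,\eta_1}\cdots y_{s_d,\eta_d};T)$ (value $1$ for $d=0$). Symmetrized values: $$\zeta_\ast^{\mathcal{S}}\binom{\mathbf{s}}{\boldsymbol\eta}:=\sum_{j=0}^d(-1)^{s_1+\cdots+s_j}\,\overline{\eta_1}\cdots\overline{\eta_j}\;\zeta_\ast\Big(\begin{smallmatrix}s_j,\dots,s_1\\ \overline{\eta_j},\dots,\overline{\eta_1}\end{smallmatrix}\Big|T\Big)\,\zeta_\ast\Big(\begin{smallmatrix}s_{j+1},\dots,s_d\\ \eta_{j+1},\dots,\eta_d\end{smallmatrix}\Big|T\Big),$$ which is known to be independent of $T$ (a complex number). *)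

theory Defs
  imports Complex_Main "HOL-Library.Poly_Mapping" "HOL-Computational_Algebra.Polynomial"
begin

text \<open>The pair \<open>(m, \<mu>)\<close> is the letter \<open>y\<^bsub>m,\<mu>\<^esub>\<close>. Noncommutative polynomials over the rationals are
  finitely supported functions on words; those with letters as prescribed by the level \<open>N\<close> form
  the carrier \<open>alg1 N\<close>.\<close>

type_synonym letter = "nat \<times> complex"
type_synonym ncpoly = "letter list \<Rightarrow>\<^sub>0 rat"

definition words1 :: "nat \<Rightarrow> letter list set" where
  "words1 N = {w. \<forall>(m, \<mu>) \<in> set w. m \<ge> 1 \<and> \<mu> ^ N = 1}"

definition words0 :: "nat \<Rightarrow> letter list set" where
  "words0 N = {w \<in> words1 N. \<not> (\<exists>u. w = (1, 1) # u)}"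

definition alg1 :: "nat \<Rightarrow> ncpoly set" where
  "alg1 N = {x. Poly_Mapping.keys x \<subseteq> words1 N}"

abbreviation of_word :: "letter list \<Rightarrow> ncpoly" where
  "of_word w \<equiv> Poly_Mapping.single w 1"

definition scale :: "rat \<Rightarrow> ncpoly \<Rightarrow> ncpoly" where
  "scale c x = Poly_Mapping.map ((*) c) x"

definition prepend :: "letter \<Rightarrow> ncpoly \<Rightarrow> ncpoly" where
  "prepend a x = (\<Sum>w \<in> Poly_Mapping.keys x. scale (Poly_Mapping.lookup x w) (of_word (a # w)))"

fun stuffle_word :: "letter list \<Rightarrow> letter list \<Rightarrow> ncpoly" where
  "stuffle_word [] w = of_word w"
| "stuffle_word w [] = of_word w"
| "stuffle_word ((m, \<mu>) # u) ((n, \<nu>) # v) =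
     prepend (m, \<mu>) (stuffle_word u ((n, \<nu>) # v))
   + prepend (n, \<nu>) (stuffle_word ((m, \<mu>) # u) v)
   + prepend (m + n, \<mu> * \<nu>) (stuffle_word u v)"

definition stuffle :: "ncpoly \<Rightarrow> ncpoly \<Rightarrow> ncpoly" where
  "stuffle x y = (\<Sum>u \<in> Poly_Mapping.keys x. \<Sum>v \<in> Poly_Mapping.keys y.
     scale (Poly_Mapping.lookup x u * Poly_Mapping.lookup y v) (stuffle_word u v))"

text \<open>Unital homomorphisms of rational algebras from \<open>alg1 N\<close> with the stuffle product to a
  commutative ring with scalar multiplication \<open>sc\<close> by rationals. Only the values on \<open>alg1 N\<close>
  are constrained.\<close>

definition stuffle_alg_hom ::
    "nat \<Rightarrow> (rat \<Rightarrow> 'b \<Rightarrow> 'b) \<Rightarrow> (ncpoly \<Rightarrow> 'b::comm_ring_1) \<Rightarrow> bool" where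
  "stuffle_alg_hom N sc Z \<longleftrightarrow>
     (\<forall>x \<in> alg1 N. \<forall>y \<in> alg1 N. Z (x + y) = Z x + Z y) \<and>
     (\<forall>c. \<forall>x \<in> alg1 N. Z (scale c x) = sc c (Z x)) \<and>
     Z (of_word []) = 1 \<and>
     (\<forall>x \<in> alg1 N. \<forall>y \<in> alg1 N. Z (stuffle x y) = Z x * Z y)"

definition cmzv_partial :: "nat \<Rightarrow> letter list \<Rightarrow> complex" where
  "cmzv_partial n w =
     (\<Sum>ks | length ks = length w \<and> sorted_wrt (>) ks \<and> set ks \<subseteq> {1..n}.
        \<Prod>i<length w. snd (w ! i) ^ (ks ! i) / of_nat (ks ! i) ^ fst (w ! i))"

definition cmzv :: "letter list \<Rightarrow> complex" where
  "cmzv w = lim (\<lambda>n. cmzv_partial n w)"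

definition is_regularization :: "nat \<Rightarrow> (ncpoly \<Rightarrow> complex poly) \<Rightarrow> bool" where
  "is_regularization N Z \<longleftrightarrow>
     stuffle_alg_hom N (\<lambda>c. smult (of_rat c)) Z \<and>
     (\<forall>w \<in> words0 N. Z (of_word w) = [:cmzv w:]) \<and>
     Z (of_word [(1, 1)]) = [:0, 1:]"

text \<open>For \<open>N \<ge> 1\<close> the regularization exists and is unique on \<open>alg1 N\<close>; the choice operator leaves
  only the irrelevant values outside \<open>alg1 N\<close> unspecified.\<close>

definition zeta_star :: "nat \<Rightarrow> letter list \<Rightarrow> complex poly" where
  "zeta_star N w = (SOME Z. is_regularization N Z) (of_word w)"

definition zeta_sym_poly :: "nat \<Rightarrow> letter list \<Rightarrow> complex poly" where
  "zeta_sym_poly N w =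
     (\<Sum>j\<le>length w.
        smult ((- 1) ^ (\<Sum>(s, \<eta>) \<leftarrow> take j w. s) * (\<Prod>(s, \<eta>) \<leftarrow> take j w. cnj \<eta>))
          (zeta_star N (rev (map (\<lambda>(s, \<eta>). (s, cnj \<eta>)) (take j w))) * zeta_star N (drop j w)))"

text \<open>The polynomial \<open>zeta_sym_poly N w\<close> is constant for \<open>w \<in> words1 N\<close>, \<open>N \<ge> 1\<close>.\<close>

definition zeta_sym_word :: "nat \<Rightarrow> letter list \<Rightarrow> complex" where
  "zeta_sym_word N w = (THE c. zeta_sym_poly N w = [:c:])"

definition zeta_sym :: "nat \<Rightarrow> ncpoly \<Rightarrow> complex" where
  "zeta_sym N x =
     (\<Sum>w \<in> Poly_Mapping.keys x. of_rat (Poly_Mapping.lookup x w) * zeta_sym_word N w)"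

end

theory Submission
  imports "HOL-Analysis.Harmonic_Numbers" "HOL-Real_Asymp.Real_Asymp"
    "HOL-Computational_Algebra.Fundamental_Theorem_Algebra" Defs
begin

text \<open>
  Truncate the symmetrized value to the nested sum of the terms \<open>\<eta>\<^bsub>i\<^esub> ^ k / k ^ s\<^bsub>i\<^esub>\<close> over strictly
  monotone chains in the ordered set \<open>-1, -2, \<dots>, -n, n, \<dots>, 2, 1\<close>, the factor at a negative point
  \<open>-k\<close> being \<open>(-1) ^ s * cnj \<eta> * cnj \<eta> ^ k / k ^ s\<close>. Nested sums over any finite chain of points are
  characters of the stuffle product as soon as the factor at each point is multiplicative in the
  letter, so it suffices that the truncations converge to \<open>zeta_sym_word\<close>.

  Every nested harmonic sum is a polynomial in the harmonic number \<open>H\<^sub>n\<close> up to an error that stays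
  null after multiplication by any power of \<open>H\<^sub>n\<close>; these polynomials give the regularization.
  Hence the truncated symmetrized sum is asymptotic to \<open>zeta_sym_poly\<close> at \<open>H\<^sub>n\<close>. The latter is
  constant, since on regularized values \<open>d/dT\<close> removes a leading letter \<open>(1, 1)\<close>, and the two ways
  of doing this on either side of the cut cancel.
\<close>

subsection \<open>Linear functionals on words\<close>

text \<open>Polynomial-valued maps are brought into this complex-valued form by evaluation at a
  fixed \<open>T\<close>.\<close>

definition lin :: "(letter list \<Rightarrow> complex) \<Rightarrow> ncpoly \<Rightarrow> complex" where
  "lin f x = (\<Sum>w \<in> Poly_Mapping.keys x. of_rat (Poly_Mapping.lookup x w) * f w)"

lemma lin_superset:
  assumes "finite K" "Poly_Mapping.keys x \<subseteq> K"
  shows "lin f x = (\<Sum>w\<in>K. of_rat (Poly_Mapping.lookup x w) * f w)"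
  unfolding lin_def using assms
  by (intro sum.mono_neutral_left) (auto simp: in_keys_iff)

lemma lin_add: "lin f (x + y) = lin f x + lin f y"
proof -
  let ?K = "Poly_Mapping.keys x \<union> Poly_Mapping.keys y"
  show ?thesis
    using lin_superset[of ?K x f] lin_superset[of ?K y f] lin_superset[of ?K "x + y" f]
      Poly_Mapping.keys_add[of x y]
    by (simp add: lookup_add of_rat_add algebra_simps sum.distrib)
qed

lemma lin_zero [simp]: "lin f 0 = 0"
  by (simp add: lin_def)

lemma lin_sum: "lin f (\<Sum>i\<in>I. g i) = (\<Sum>i\<in>I. lin f (g i))"
  by (induction I rule: infinite_finite_induct) (auto simp: lin_add)

lemma lookup_scale: "Poly_Mapping.lookup (scale c x) w = c * Poly_Mapping.lookup x w"
  by (simp add: scale_def Poly_Mapping.map.rep_eq when_def)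

lemma keys_scale: "Poly_Mapping.keys (scale c x) \<subseteq> Poly_Mapping.keys x"
  by (auto simp: in_keys_iff lookup_scale)

lemma lin_scale: "lin f (scale c x) = of_rat c * lin f x"
  by (subst lin_superset[OF _ keys_scale])
    (auto simp: lin_def lookup_scale of_rat_mult sum_distrib_left mult.assoc)

lemma lin_of_word [simp]: "lin f (of_word w) = f w"
  by (simp add: lin_def)

lemma lin_prepend: "lin f (prepend a x) = lin (\<lambda>w. f (a # w)) x"
  by (simp add: prepend_def lin_sum lin_scale) (simp add: lin_def)

lemma lin_zero_fun [simp]: "lin (\<lambda>w. 0) x = 0"
  by (simp add: lin_def)

lemma lin_plus_fun: "lin (\<lambda>w. f w + g w) x = lin f x + lin g x"
  by (simp add: lin_def sum.distrib algebra_simps)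

lemma lin_diff_fun: "lin (\<lambda>w. f w - g w) x = lin f x - lin g x"
  by (simp add: lin_def sum_subtractf algebra_simps)

lemma lin_cmult_fun: "lin (\<lambda>w. c * f w) x = c * lin f x"
  by (simp add: lin_def sum_distrib_left algebra_simps)

section \<open>Supports of stuffle products of words\<close>

lemma lookup_prepend:
  "Poly_Mapping.lookup (prepend a x) v =
     (case v of [] \<Rightarrow> 0 | b # w \<Rightarrow> if b = a then Poly_Mapping.lookup x w else 0)"
proof (cases v)
  case Nil
  then show ?thesis
    by (simp add: prepend_def lookup_sum lookup_scale lookup_single)
next
  case (Cons b w)
  have "Poly_Mapping.lookup (prepend a x) v =
      (\<Sum>u\<in>Poly_Mapping.keys x. if u = w \<and> b = a then Poly_Mapping.lookup x u else 0)"
    unfolding prepend_def lookup_sum lookup_scale lookup_single Cons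
    by (intro sum.cong) (auto simp: when_def)
  also have "\<dots> = (if b = a then Poly_Mapping.lookup x w else 0)"
    by (auto simp: in_keys_iff)
  finally show ?thesis by (simp add: Cons)
qed

lemma keys_prepend: "Poly_Mapping.keys (prepend a x) = (#) a ` Poly_Mapping.keys x"
  by (auto simp: in_keys_iff lookup_prepend split: list.splits if_splits)

lemma Nil_words1 [simp]: "[] \<in> words1 N"
  by (simp add: words1_def)

lemma Cons_words1 [simp]:
  "a # w \<in> words1 N \<longleftrightarrow> fst a \<ge> 1 \<and> snd a ^ N = 1 \<and> w \<in> words1 N"
  by (auto simp: words1_def split: prod.splits)

lemma stuffle_word_Nil_right [simp]: "stuffle_word w [] = of_word w"
  by (cases w) auto

lemma keys_add3:
  "Poly_Mapping.keys (x + y + z) \<subseteq>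
     Poly_Mapping.keys x \<union> Poly_Mapping.keys y \<union> Poly_Mapping.keys z"
  using Poly_Mapping.keys_add[of x y] Poly_Mapping.keys_add[of "x + y" z] by blast

lemma keys_stuffle_word:
  "u \<in> words1 N \<Longrightarrow> v \<in> words1 N \<Longrightarrow> Poly_Mapping.keys (stuffle_word u v) \<subseteq> words1 N"
proof (induction u v rule: stuffle_word.induct)
  case (3 m \<mu> u n \<nu> v)
  note [simp] = power_mult_distrib
  have "Poly_Mapping.keys (stuffle_word ((m, \<mu>) # u) ((n, \<nu>) # v)) \<subseteq>
      Poly_Mapping.keys (prepend (m, \<mu>) (stuffle_word u ((n, \<nu>) # v))) \<union>
      Poly_Mapping.keys (prepend (n, \<nu>) (stuffle_word ((m, \<mu>) # u) v)) \<union>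
      Poly_Mapping.keys (prepend (m + n, \<mu> * \<nu>) (stuffle_word u v))"
    unfolding stuffle_word.simps by (rule keys_add3)
  also have "\<dots> \<subseteq> words1 N"
    using 3 unfolding keys_prepend by auto
  finally show ?case .
qed auto

lemma stuffle_of_word: "stuffle (of_word u) (of_word v) = stuffle_word u v"
  by (rule poly_mapping_eqI) (simp add: stuffle_def lookup_scale)

text \<open>Both sides are bilinear, so multiplicativity need only be known on pairs of
  words.\<close>

lemma lin_stuffle:
  assumes "\<And>u v. u \<in> words1 N \<Longrightarrow> v \<in> words1 N \<Longrightarrow> lin f (stuffle_word u v) = f u * f v"
    and "x \<in> alg1 N" "y \<in> alg1 N"
  shows "lin f (stuffle x y) = lin f x * lin f y"
proof -
  have "lin f (stuffle x y) = (\<Sum>u\<in>Poly_Mapping.keys x. \<Sum>v\<in>Poly_Mapping.keys y.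
      of_rat (Poly_Mapping.lookup x u) * f u * (of_rat (Poly_Mapping.lookup y v) * f v))"
    unfolding stuffle_def lin_sum lin_scale
    using assms by (intro sum.cong) (auto simp: alg1_def subset_iff of_rat_mult)
  then show ?thesis
    by (simp add: lin_def sum_product)
qed

subsection \<open>Induction on leading letters (1, 1)\<close>

text \<open>The measure for the induction below: its level zero within \<open>words1 N\<close> is
  \<open>words0 N\<close>.\<close>

fun leading_ones :: "letter list \<Rightarrow> nat" where
  "leading_ones [] = 0"
| "leading_ones (a # w) = (if a = (1, 1) then Suc (leading_ones w) else 0)"

lemma words0_iff: "w \<in> words0 N \<longleftrightarrow> w \<in> words1 N \<and> leading_ones w = 0"
  by (cases w) (auto simp: words0_def)

lemma stuffle_word_one_Cons:
  "stuffle_word [(1, 1)] (a # u) = of_word ((1, 1) # a # u)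
     + prepend a (stuffle_word [(1, 1)] u) + of_word ((Suc (fst a), snd a) # u)"
proof -
  have "prepend b (of_word w) = of_word (b # w)" for b w
    by (rule poly_mapping_eqI) (simp add: prepend_def lookup_scale)
  then show ?thesis by (cases a) simp
qed

text \<open>No summand of the recursion has a negative coefficient and the concatenation itself
  contributes 1. Hence the product of \<open>(1, 1)\<close> with \<open>u\<close> can be solved for
  \<open>(1, 1) # u\<close>.\<close>

lemma lookup_stuffle_one_pos:
  "Poly_Mapping.lookup (stuffle_word [(1, 1)] u) ((1, 1) # u) > 0"
proof (induction u)
  case (Cons a u)
  have "fst a = 0 \<Longrightarrow> Poly_Mapping.lookup (of_word ((Suc (fst a), snd a) # u)) ((1, 1) # a # u) = 0"
    by (auto simp: lookup_single when_def)
  moreover have "Poly_Mapping.lookup (of_word ((Suc (fst a), snd a) # u)) ((1, 1) # a # u) \<ge> 0"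
    by (simp add: lookup_single when_def)
  ultimately show ?case
    using Cons unfolding stuffle_word_one_Cons lookup_add lookup_prepend
    by (auto simp: lookup_single when_def)
qed (simp add: lookup_single)

text \<open>Inserting \<open>(1, 1)\<close> into the leading block or just after it gives
  \<open>(1, 1) # u\<close> itself; inserting it later keeps the block. Merging it with a letter of
  weight at least 1 gives weight at least 2, which can only shorten the block.\<close>

lemma keys_stuffle_one:
  assumes "u \<in> words1 N" "v \<in> Poly_Mapping.keys (stuffle_word [(1, 1)] u)" "v \<noteq> (1, 1) # u"
  shows "leading_ones v \<le> leading_ones u"
  using assms
proof (induction u arbitrary: v)
  case (Cons a u)
  have "v \<in> Poly_Mapping.keys (of_word ((1, 1) # a # u)) \<union>
      Poly_Mapping.keys (prepend a (stuffle_word [(1, 1)] u)) \<union>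
      Poly_Mapping.keys (of_word ((Suc (fst a), snd a) # u))"
    using subsetD[OF keys_add3 Cons.prems(2)[unfolded stuffle_word_one_Cons]] .
  then consider "v = (Suc (fst a), snd a) # u"
    | v' where "v = a # v'" "v' \<in> Poly_Mapping.keys (stuffle_word [(1, 1)] u)"
    using Cons.prems(3) by (auto simp: keys_prepend)
  then show ?case
  proof cases
    case 1
    then show ?thesis using Cons.prems(1) by auto
  next
    case 2
    \<comment> \<open>If \<open>v'\<close> is \<open>(1, 1) # u\<close>, then \<open>a\<close> is
      not \<open>(1, 1)\<close> by the assumption on \<open>v\<close>, so \<open>v\<close> has no
      leading ones at all.\<close>
    then show ?thesis
      using Cons.IH[of v'] Cons.prems by (cases "v' = (1, 1) # u") auto
  qed
qed auto

text \<open>The stuffle product of \<open>(1, 1)\<close> with \<open>u\<close> is a nonzero multiple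
  of \<open>(1, 1) # u\<close> plus words with fewer leading ones. The step may thus assume
  \<open>P\<close> for these words and for \<open>u\<close>, and use the product to reach
  \<open>(1, 1) # u\<close>.\<close>

lemma words1_induct [consumes 1, case_names words0 one]:
  assumes "w \<in> words1 N"
    and base: "\<And>w. w \<in> words0 N \<Longrightarrow> P w"
    and step: "\<And>u. \<lbrakk>u \<in> words1 N; P u;
        \<And>v. \<lbrakk>v \<in> Poly_Mapping.keys (stuffle_word [(1, 1)] u); v \<noteq> (1, 1) # u\<rbrakk> \<Longrightarrow> P v\<rbrakk>
      \<Longrightarrow> P ((1, 1) # u)"
  shows "P w"
  using assms(1)
proof (induction "leading_ones w" arbitrary: w rule: less_induct)
  case less
  show ?case
  proof (cases "leading_ones w = 0")
    case True
    then show ?thesis using base less.prems by (simp add: words0_iff)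
  next
    case False
    then obtain u where w: "w = (1, 1) # u" by (cases w) (auto split: if_splits)
    with less.prems have u: "u \<in> words1 N" by simp
    show ?thesis unfolding w
    proof (rule step[OF u])
      show "P u" using less.hyps u w by simp
    next
      fix v assume v: "v \<in> Poly_Mapping.keys (stuffle_word [(1, 1)] u)" "v \<noteq> (1, 1) # u"
      have "v \<in> words1 N" using v(1) keys_stuffle_word[of "[(1, 1)]" N u] u by auto
      then show "P v" using less.hyps keys_stuffle_one[OF u v] w by simp
    qed
  qed
qed

lemma lin_stuffle_one:
  "lin f (stuffle_word [(1, 1)] u) =
     of_rat (Poly_Mapping.lookup (stuffle_word [(1, 1)] u) ((1, 1) # u)) * f ((1, 1) # u) +
     (\<Sum>v \<in> Poly_Mapping.keys (stuffle_word [(1, 1)] u) - {(1, 1) # u}.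
        of_rat (Poly_Mapping.lookup (stuffle_word [(1, 1)] u) v) * f v)"
  unfolding lin_def
  by (rule sum.remove) (use lookup_stuffle_one_pos[of u] in \<open>auto simp: in_keys_iff\<close>)

text \<open>A uniqueness principle, to be applied to differences of functionals. By induction the
  right-hand side and all terms of the product other than that of \<open>(1, 1) # u\<close> vanish,
  and the remaining coefficient is nonzero.\<close>

lemma vanishing_on_words1:
  assumes "w \<in> words1 N"
    and "\<And>w. w \<in> words0 N \<Longrightarrow> f w = 0"
    and "\<And>u. u \<in> words1 N \<Longrightarrow> lin f (stuffle_word [(1, 1)] u) = T * f u"
  shows "f w = 0"
  using assms(1)
proof (induction w rule: words1_induct)
  case (one u)
  have "(\<Sum>v \<in> Poly_Mapping.keys (stuffle_word [(1, 1)] u) - {(1, 1) # u}.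
      of_rat (Poly_Mapping.lookup (stuffle_word [(1, 1)] u) v) * f v) = 0"
    using one.IH(2) by (intro sum.neutral ballI) (simp del: One_nat_def)
  then show ?case
    using assms(3)[OF one.hyps] one.IH(1) lookup_stuffle_one_pos[of u]
    unfolding lin_stuffle_one by (simp del: One_nat_def)
qed (simp add: assms)

subsection \<open>Nested sums over chains of points\<close>

text \<open>A point is encoded as the function that gives the factor of each letter there. The sum
  runs over all placements of the letters, in order, at strictly increasing positions of the
  list.\<close>

fun nested :: "(letter \<Rightarrow> complex) list \<Rightarrow> letter list \<Rightarrow> complex" where
  "nested ps [] = 1"
| "nested [] (a # w) = 0"
| "nested (p # ps) (a # w) = p a * nested ps w + nested ps (a # w)"

lemma nested_no_points: "nested [] w = (if w = [] then 1 else 0)"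
  by (cases w) auto

text \<open>The first point is taken by the first letter of \<open>u\<close>, of \<open>v\<close>,
  of both or of neither. Multiplicativity of the factor turns the case of both into the merged
  letter.\<close>

lemma nested_stuffle:
  assumes "\<And>p m n \<mu> \<nu>. p \<in> set ps \<Longrightarrow> p (m + n, \<mu> * \<nu>) = p (m, \<mu>) * p (n, \<nu>)"
  shows "lin (nested ps) (stuffle_word u v) = nested ps u * nested ps v"
  using assms
proof (induction ps arbitrary: u v)
  case Nil
  show ?case
    by (induction u v rule: stuffle_word.induct)
      (simp_all add: lin_add lin_prepend lin_zero_fun nested_no_points)
next
  case (Cons p ps)
  have IH: "lin (nested ps) (stuffle_word u v) = nested ps u * nested ps v" for u v
    by (rule Cons.IH) (use Cons.prems in auto)
  have p: "p (m + n, \<mu> * \<nu>) = p (m, \<mu>) * p (n, \<nu>)" for m n \<mu> \<nu>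
    using Cons.prems by simp
  show ?case
  proof (cases "u = [] \<or> v = []")
    case False
    then obtain m \<mu> u' n \<nu> v' where uv: "u = (m, \<mu>) # u'" "v = (n, \<nu>) # v'"
      by (metis list.exhaust surj_pair)
    have "lin (nested (p # ps)) (stuffle_word u v) =
        p (m, \<mu>) * lin (nested ps) (stuffle_word u' v) +
        p (n, \<nu>) * lin (nested ps) (stuffle_word u v') +
        p (m + n, \<mu> * \<nu>) * lin (nested ps) (stuffle_word u' v') +
        lin (nested ps) (stuffle_word u v)"
      by (simp add: uv lin_add lin_prepend lin_plus_fun lin_cmult_fun)
    then show ?thesis
      unfolding IH p by (simp add: uv algebra_simps)
  qed auto
qed

text \<open>Each chain is cut where it passes from \<open>ps\<close> to \<open>qs\<close>;
  \<open>j\<close> counts the letters placed in \<open>ps\<close>.\<close>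

lemma nested_append:
  "nested (ps @ qs) w = (\<Sum>j\<le>length w. nested ps (take j w) * nested qs (drop j w))"
proof (induction ps arbitrary: w)
  case Nil
  show ?case
  proof (cases w)
    case (Cons a w')
    show ?thesis unfolding Cons
      by (simp add: sum.atMost_Suc_shift nested_no_points del: sum.atMost_Suc)
  qed simp
next
  case (Cons p ps)
  show ?case
  proof (cases w)
    case (Cons a w')
    show ?thesis
      using Cons.IH[of w'] Cons.IH[of "a # w'"] unfolding Cons
      by (simp add: sum.atMost_Suc_shift sum.distrib sum_distrib_left algebra_simps
          del: sum.atMost_Suc)
  qed simp
qed

lemma nested_snoc:
  "nested (ps @ [p]) (w @ [a]) = nested ps (w @ [a]) + nested ps w * p a"
proof (induction ps arbitrary: w)
  case Nil
  show ?case by (cases w) (simp_all add: nested_no_points)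
next
  case (Cons q ps)
  show ?case
    using Cons.IH[of w] Cons.IH[of "tl w"] by (cases w) (auto simp: algebra_simps)
qed

text \<open>Chains may be read backwards. This accounts for the reversed words in the symmetrized
  values.\<close>

lemma nested_rev: "nested (rev ps) (rev w) = nested ps w"
proof (induction ps arbitrary: w)
  case Nil
  show ?case by (simp add: nested_no_points)
next
  case (Cons p ps)
  show ?case
    using Cons.IH Cons.IH[of "_ # _"] by (cases w) (auto simp: nested_snoc algebra_simps)
qed

subsection \<open>Truncated colored multiple zeta values\<close>

definition point :: "nat \<Rightarrow> letter \<Rightarrow> complex" where
  "point k a = snd a ^ k / of_nat k ^ fst a"

text \<open>The points run from \<open>n\<close> down to 1, matching the summation order
  \<open>k_1 > k_2 > ...\<close>.\<close>

definition harmonic_sum :: "nat \<Rightarrow> letter list \<Rightarrow> complex" where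
  "harmonic_sum n = nested (rev (map point [1..<Suc n]))"

lemma point_mult: "point k (m + n, \<mu> * \<nu>) = point k (m, \<mu>) * point k (n, \<nu>)"
  by (simp add: point_def power_add power_mult_distrib)

lemma harmonic_sum_Nil [simp]: "harmonic_sum n [] = 1"
  by (simp add: harmonic_sum_def)

lemma harmonic_sum_0 [simp]: "harmonic_sum 0 (a # w) = 0"
  by (simp add: harmonic_sum_def)

lemma harmonic_sum_Suc [simp]:
  "harmonic_sum (Suc n) (a # w) = point (Suc n) a * harmonic_sum n w + harmonic_sum n (a # w)"
  by (simp add: harmonic_sum_def)

lemma harmonic_sum_stuffle:
  "lin (harmonic_sum n) (stuffle_word u v) = harmonic_sum n u * harmonic_sum n v"
  unfolding harmonic_sum_def by (rule nested_stuffle) (auto simp: point_mult)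

lemma harmonic_sum_one: "harmonic_sum n [(1, 1)] = harm n"
  by (induction n) (simp_all add: harm_Suc harm_def point_def field_simps)

section \<open>Agreement of the recursion with the sum over index tuples\<close>

definition indices :: "nat \<Rightarrow> nat \<Rightarrow> nat list set" where
  "indices n d = {ks. length ks = d \<and> sorted_wrt (>) ks \<and> set ks \<subseteq> {1..n}}"

lemma finite_indices: "finite (indices n d)"
  by (rule finite_subset[OF _ finite_lists_length_eq[of "{1..n}" d]]) (auto simp: indices_def)

lemma Cons_indices_iff:
  "k # ks \<in> indices n (Suc d) \<longleftrightarrow> ks \<in> indices (k - 1) d \<and> 1 \<le> k \<and> k \<le> n"
proof -
  \<comment> \<open>Since \<open>1 \<le> k\<close>, the subtraction \<open>k - 1\<close> of natural
    numbers does not truncate.\<close>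
  have *: "x < k \<and> x \<in> {1..n} \<longleftrightarrow> x \<in> {1..k - 1}" if "1 \<le> k" "k \<le> n" for x
    using that by auto
  have "k # ks \<in> indices n (Suc d) \<longleftrightarrow>
      length ks = d \<and> sorted_wrt (>) ks \<and> k \<in> {1..n} \<and> (\<forall>x\<in>set ks. x < k \<and> x \<in> {1..n})"
    unfolding indices_def by (simp add: subset_iff) blast
  also have "\<dots> \<longleftrightarrow> length ks = d \<and> sorted_wrt (>) ks \<and> k \<in> {1..n} \<and> set ks \<subseteq> {1..k - 1}"
    using * by (auto simp: subset_eq simp del: atLeastAtMost_iff) auto
  finally show ?thesis unfolding indices_def by auto
qed

lemma indices_Suc:
  "indices (Suc n) (Suc d) = (#) (Suc n) ` indices n d \<union> indices n (Suc d)"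
proof (intro set_eqI)
  fix ks
  show "ks \<in> indices (Suc n) (Suc d) \<longleftrightarrow> ks \<in> (#) (Suc n) ` indices n d \<union> indices n (Suc d)"
  proof (cases ks)
    case Nil
    then show ?thesis by (auto simp: indices_def)
  next
    case (Cons k ks')
    then show ?thesis by (auto simp: Cons_indices_iff image_iff le_Suc_eq)
  qed
qed

text \<open>Separating the tuples with largest index \<open>Suc n\<close> reproduces the recursion
  of \<open>harmonic_sum\<close>.\<close>

lemma cmzv_partial_eq: "cmzv_partial n w = harmonic_sum n w"
proof -
  have part: "cmzv_partial n w = (\<Sum>ks\<in>indices n (length w). \<Prod>i<length w. point (ks ! i) (w ! i))"
    for n w
    by (simp add: cmzv_partial_def indices_def point_def)
  show ?thesis
  proof (induction n arbitrary: w)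
    case 0
    have "indices 0 (Suc d) = {}" for d
      by (auto simp: indices_def)
    moreover have "indices 0 0 = {[]}"
      by (auto simp: indices_def)
    ultimately show ?case
      by (cases w) (simp_all add: part)
  next
    case (Suc n)
    show ?case
    proof (cases w)
      case Nil
      have "indices (Suc n) 0 = {[]}"
        by (auto simp: indices_def)
      then show ?thesis by (simp add: part Nil)
    next
      case (Cons a u)
      have "cmzv_partial (Suc n) w =
          (\<Sum>ks\<in>(#) (Suc n) ` indices n (length u). \<Prod>i<length w. point (ks ! i) (w ! i)) +
          (\<Sum>ks\<in>indices n (length w). \<Prod>i<length w. point (ks ! i) (w ! i))"
        unfolding part by (simp only: Cons length_Cons indices_Suc)
          (rule sum.union_disjoint, auto simp: finite_indices Cons_indices_iff)
      also have "(\<Sum>ks\<in>(#) (Suc n) ` indices n (length u). \<Prod>i<length w. point (ks ! i) (w ! i)) =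
          point (Suc n) a * cmzv_partial n u"
        by (subst sum.reindex)
          (auto simp: part Cons prod.lessThan_Suc_shift sum_distrib_left simp del: prod.lessThan_Suc)
      finally show ?thesis
        unfolding part[of n w, symmetric] Suc by (simp add: Cons)
    qed
  qed
qed

section \<open>Growth of the truncated sums\<close>

lemma norm_root_of_unity:
  fixes z :: complex
  assumes "z ^ N = 1" "N \<ge> 1"
  shows "norm z = 1"
  using assms by (metis One_nat_def Suc_le_lessD norm_ge_zero norm_one norm_power power_eq_imp_eq_base power_one)

lemma norm_point:
  assumes "norm (snd a) = 1"
  shows "norm (point k a) = 1 / of_nat k ^ fst a"
  using assms by (simp add: point_def norm_divide norm_power)

text \<open>Every letter has modulus at most \<open>1 / k\<close> at the point \<open>k\<close>. The
  contribution of a new point is absorbed by the growth of one factor from \<open>harm n\<close> to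
  \<open>harm (Suc n)\<close>.\<close>

lemma harmonic_sum_bound_harm:
  assumes "N \<ge> 1" "w \<in> words1 N"
  shows "norm (harmonic_sum n w) \<le> harm n ^ length w"
  using assms(2)
proof (induction n arbitrary: w)
  case 0
  show ?case by (cases w) (simp_all add: harm_nonneg)
next
  case (Suc n)
  show ?case
  proof (cases w)
    case (Cons a u)
    have a: "norm (snd a) = 1" "fst a \<ge> 1" and u: "u \<in> words1 N"
      using Suc.prems assms(1) norm_root_of_unity by (auto simp: Cons)
    have "(1::real) / of_nat (Suc n) ^ fst a \<le> 1 / of_nat (Suc n)"
      using a(2) self_le_power[of "real (Suc n)" "fst a"] by (intro divide_left_mono) auto
    then have p: "norm (point (Suc n) a) \<le> inverse (of_nat (Suc n))"
      unfolding norm_point[OF a(1)] by (simp add: field_simps)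
    have "norm (harmonic_sum (Suc n) w) \<le>
        norm (point (Suc n) a) * norm (harmonic_sum n u) + norm (harmonic_sum n w)"
      using norm_triangle_ineq[of "point (Suc n) a * harmonic_sum n u" "harmonic_sum n w"]
      by (simp add: Cons norm_mult)
    also have "\<dots> \<le> inverse (of_nat (Suc n)) * harm n ^ length u + harm n ^ length w"
      using p Suc.IH[OF u] Suc.IH[OF Suc.prems]
      by (intro add_mono mult_mono) auto
    also have "\<dots> = harm (Suc n) * harm n ^ length u"
      by (simp add: Cons harm_Suc algebra_simps)
    also have "\<dots> \<le> harm (Suc n) * harm (Suc n) ^ length u"
      by (intro mult_left_mono power_mono harm_mono harm_nonneg) simp
    finally show ?thesis by (simp add: Cons)
  qed simp
qed

text \<open>The difference \<open>harm n - ln n\<close> decreases from its value 1 at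
  \<open>n = 1\<close>.\<close>

lemma harm_le_ln: "n > 0 \<Longrightarrow> (harm n :: real) \<le> ln (real n) + 1"
proof -
  assume "n > 0"
  then obtain m where n: "n = Suc m" by (cases n) auto
  have "harm (Suc m) - ln (real (Suc m)) \<le> harm (Suc 0) - ln (real (Suc 0))"
    using decseqD[OF decseq_harm_diff_ln, of 0 m] by simp
  then show ?thesis by (simp add: n harm_def)
qed

lemma harm_power_over_sqrt: "(\<lambda>n. harm n ^ k / sqrt (real n + 1)) \<longlonglongrightarrow> (0::real)"
proof (rule tendsto_sandwich)
  show "eventually (\<lambda>n. 0 \<le> (harm n :: real) ^ k / sqrt (real n + 1)) sequentially"
    by (simp add: harm_nonneg)
  show "eventually (\<lambda>n. (harm n :: real) ^ k / sqrt (real n + 1) \<le>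
      (ln (real n) + 1) ^ k / sqrt (real n + 1)) sequentially"
    using eventually_gt_at_top[of 0]
    by eventually_elim (intro divide_right_mono power_mono harm_le_ln harm_nonneg, auto)
  show "(\<lambda>n. (ln (real n) + 1) ^ k / sqrt (real n + 1)) \<longlonglongrightarrow> 0"
    by real_asymp
qed simp

text \<open>A half power of \<open>n\<close> majorizes all powers of the logarithm, yet division by
  \<open>n ^ 2\<close> still leaves order \<open>n ^ (-3/2)\<close>, which is summable with tails of
  order \<open>1 / sqrt n\<close>.\<close>

lemma harmonic_sum_bound:
  assumes "N \<ge> 1" "w \<in> words1 N"
  obtains C where "C \<ge> 0" "\<And>n. norm (harmonic_sum n w) \<le> C * sqrt (real n + 1)"
proof -
  have "Bseq (\<lambda>n. harm n ^ length w / sqrt (real n + 1))"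
    by (rule convergent_imp_Bseq) (use harm_power_over_sqrt in \<open>auto simp: convergent_def\<close>)
  then obtain C where C: "C > 0" "\<And>n. norm (harm n ^ length w / sqrt (real n + 1)) \<le> C"
    by (auto simp: Bseq_def)
  have "norm (harmonic_sum n w) \<le> C * sqrt (real n + 1)" for n
  proof -
    have "harm n ^ length w / sqrt (real n + 1) \<le> C"
      using C(2)[of n] by (simp add: harm_nonneg)
    then have "harm n ^ length w \<le> C * sqrt (real n + 1)"
      by (simp add: divide_le_eq add_pos_nonneg)
    then show ?thesis
      using harmonic_sum_bound_harm[OF assms, of n] by linarith
  qed
  then show thesis using that[of C] C(1) by auto
qed

section \<open>Convergence with an explicit rate\<close>

text \<open>Telescoping bounds \<open>f m - f n\<close> by \<open>b n - b m\<close>, hence by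
  \<open>b n\<close>, for \<open>m \<ge> n\<close>. Letting \<open>m\<close> tend to infinity gives
  the rate.\<close>

lemma convergence_rate:
  fixes f :: "nat \<Rightarrow> complex"
  assumes f: "\<And>n. norm (f (Suc n) - f n) \<le> b n - b (Suc n)" and b: "b \<longlonglongrightarrow> (0::real)"
  obtains L where "f \<longlonglongrightarrow> L" "\<And>n. norm (f n - L) \<le> b n"
proof -
  have diff: "norm (f (n + k) - f n) \<le> b n - b (n + k)" for n k
  proof (induction k)
    case (Suc k)
    then show ?case
      using f[of "n + k"] norm_triangle_ineq[of "f (Suc (n + k)) - f (n + k)" "f (n + k) - f n"]
      by simp
  qed simp
  have "decseq b"
  proof (rule decseq_SucI)
    show "b (Suc n) \<le> b n" for n
      using f[of n] norm_ge_zero[of "f (Suc n) - f n"] by linarith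
  qed
  then have b0: "b n \<ge> 0" for n
    by (rule decseq_ge[OF _ b])
  have diff': "norm (f m - f n) \<le> b n" if "m \<ge> n" for m n
    using diff[of n "m - n"] b0[of m] that by simp
  have "Cauchy f"
  proof (rule CauchyI')
    fix e :: real assume "e > 0"
    then obtain M where M: "\<forall>n\<ge>M. norm (b n - 0) < e"
      using LIMSEQ_D[OF b] by blast
    show "\<exists>M. \<forall>m\<ge>M. \<forall>n>m. dist (f m) (f n) < e"
    proof (intro exI allI impI)
      fix m n assume "m \<ge> M" "n > m"
      then have "norm (f n - f m) \<le> b m" "b m < e"
        using diff'[of m n] M b0[of m] by auto
      then show "dist (f m) (f n) < e"
        by (simp add: dist_norm norm_minus_commute)
    qed
  qed
  then obtain L where L: "f \<longlonglongrightarrow> L"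
    unfolding Cauchy_convergent_iff convergent_def by blast
  have "norm (f n - L) \<le> b n" for n
  proof -
    have "(\<lambda>m. norm (f m - f n)) \<longlonglongrightarrow> norm (L - f n)"
      by (intro tendsto_intros L)
    then have "norm (L - f n) \<le> b n"
      by (rule tendsto_upperbound) (auto intro: eventually_sequentiallyI diff')
    then show ?thesis by (simp add: norm_minus_commute)
  qed
  with L show thesis by (rule that)
qed

text \<open>Provides a telescoping majorant for terms of order \<open>n ^ (-3/2)\<close>.\<close>

lemma inverse_sqrt_telescope:
  assumes "x \<ge> (1::real)"
  shows "1 / (x * sqrt x) \<le> 4 * (1 / sqrt x - 1 / sqrt (x + 1))"
proof -
  define a b where "a = sqrt x" and "b = sqrt (x + 1)"
  have pos: "a > 0" "b > 0" and sq: "a * a = x" "b * b = x + 1"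
    using assms by (auto simp: a_def b_def)
  \<comment> \<open>Here \<open>b ^ 2 = x + 1 \<le> 2 * x\<close>, below
    \<open>(3 / 2) ^ 2 * x\<close>. It gives \<open>b * (a + b) \<le> 15 / 4 * a ^ 2\<close>, whence
    the constant 4.\<close>
  have "b \<le> 3 / 2 * a"
    by (rule power2_le_imp_le) (use assms sq pos in \<open>auto simp: power2_eq_square\<close>)
  then have "b * (a + b) \<le> 3 / 2 * a * (a + 3 / 2 * a)"
    using pos by (intro mult_mono) auto
  also have "\<dots> \<le> 4 * (a * a)" using pos by simp
  finally have *: "b * (a + b) \<le> 4 * (a * a)" .
  have root: "sqrt (a * a) = a" "sqrt (a * a + 1) = b"
    using pos by (simp_all add: sq flip: a_def b_def)
  have "1 / a - 1 / b = (b * b - a * a) / (a * (b * (a + b)))"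
    using pos by (simp add: divide_simps) (simp add: algebra_simps)
  also have "\<dots> = 1 / (a * (b * (a + b)))" by (simp add: sq)
  also have "\<dots> \<ge> 1 / (a * (4 * (a * a)))"
    using * pos by (intro divide_left_mono mult_left_mono mult_pos_pos) auto
  finally show ?thesis
    unfolding sq(1)[symmetric] root by (simp add: field_simps)
qed

text \<open>Shaped for summation by parts: \<open>g\<close> is the small boundary term and
  \<open>r\<close> the summable remainder. The telescoping criterion applies to
  \<open>f - g\<close>, and \<open>g\<close> is restored afterwards.\<close>

lemma convergence_sqrt_rate:
  fixes f g r :: "nat \<Rightarrow> complex"
  assumes f: "\<And>n. f (Suc n) - f n = g (Suc n) - g n + r n"
    and g: "\<And>n. norm (g n) \<le> C / sqrt (real n + 1)"
    and r: "\<And>n. norm (r n) \<le> D / ((real n + 1) * sqrt (real n + 1))" and "D \<ge> 0"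
  obtains L where "f \<longlonglongrightarrow> L" "\<And>n. norm (f n - L) \<le> (C + 4 * D) / sqrt (real n + 1)"
proof -
  define b where "b n = 4 * D / sqrt (real n + 1)" for n
  have "norm ((f (Suc n) - g (Suc n)) - (f n - g n)) \<le> b n - b (Suc n)" for n
  proof -
    have "(f (Suc n) - g (Suc n)) - (f n - g n) = r n"
      using f[of n] by (simp add: algebra_simps)
    moreover have "D / ((real n + 1) * sqrt (real n + 1)) \<le> b n - b (Suc n)"
      using mult_left_mono[OF inverse_sqrt_telescope[of "real n + 1"] \<open>D \<ge> 0\<close>]
      by (simp add: b_def algebra_simps)
    ultimately show ?thesis using r[of n] by simp
  qed
  moreover have "b \<longlonglongrightarrow> 0" unfolding b_def by real_asymp
  ultimately obtain L where L: "(\<lambda>n. f n - g n) \<longlonglongrightarrow> L" "\<And>n. norm (f n - g n - L) \<le> b n"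
    using convergence_rate[of "\<lambda>n. f n - g n" b] by blast
  have rate: "norm (f n - L) \<le> (C + 4 * D) / sqrt (real n + 1)" for n
  proof -
    have "norm (f n - L) \<le> norm (f n - g n - L) + norm (g n)"
      using norm_triangle_ineq[of "f n - g n - L" "g n"] by (simp add: algebra_simps)
    also have "\<dots> \<le> b n + C / sqrt (real n + 1)" by (intro add_mono L g)
    finally show ?thesis by (simp add: b_def add_divide_distrib)
  qed
  have "(\<lambda>n. f n - L) \<longlonglongrightarrow> 0"
  proof (rule Lim_null_comparison)
    show "eventually (\<lambda>n. norm (f n - L) \<le> (C + 4 * D) / sqrt (real n + 1)) sequentially"
      using rate by simp
    show "(\<lambda>n. (C + 4 * D) / sqrt (real n + 1)) \<longlonglongrightarrow> 0" by real_asymp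
  qed
  then have "f \<longlonglongrightarrow> L" by (simp add: Lim_null[symmetric])
  from that[OF this rate] show thesis .
qed

lemma harmonic_sum_increment:
  assumes "N \<ge> 1" "w \<in> words1 N"
  obtains C where "C \<ge> 0"
    "\<And>n. norm (harmonic_sum (Suc n) w - harmonic_sum n w) \<le> C / sqrt (real n + 1)"
proof (cases w)
  case (Cons a u)
  have a: "norm (snd a) = 1" "fst a \<ge> 1" and u: "u \<in> words1 N"
    using assms norm_root_of_unity by (auto simp: Cons)
  obtain C where C: "C \<ge> 0" "\<And>n. norm (harmonic_sum n u) \<le> C * sqrt (real n + 1)"
    using harmonic_sum_bound[OF assms(1) u] by blast
  have "norm (harmonic_sum (Suc n) w - harmonic_sum n w) \<le> C / sqrt (real n + 1)" for n
  proof -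
    have "norm (harmonic_sum (Suc n) w - harmonic_sum n w) =
        norm (harmonic_sum n u) / (real n + 1) ^ fst a"
      by (simp add: Cons norm_mult norm_point[OF a(1)] add.commute)
    also have "\<dots> \<le> (C * sqrt (real n + 1)) / (real n + 1)"
      using self_le_power[of "real n + 1" "fst a"] a(2) C(1)
      by (intro frac_le C) auto
    also have "\<dots> = C / sqrt (real n + 1)"
      by (simp add: divide_simps)
    finally show ?thesis .
  qed
  with C(1) show thesis by (rule that)
qed (use that[of 0] in simp)

text \<open>If the first exponent is at least 2, the increments are absolutely summable. Otherwise
  the first root of unity is not 1, and summation by parts against its powers gains the missing
  decay.\<close>

lemma harmonic_sum_admissible:
  assumes "N \<ge> 1" "w \<in> words0 N"
  obtains L C where "(\<lambda>n. harmonic_sum n w) \<longlonglongrightarrow> L"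
    "\<And>n. norm (harmonic_sum n w - L) \<le> C / sqrt (real n + 1)"
proof (cases w)
  case Nil
  then show thesis using that[of 1 0] by simp
next
  case (Cons a u)
  have a: "norm (snd a) = 1" "fst a \<ge> 1" and u: "u \<in> words1 N"
    using assms norm_root_of_unity by (auto simp: Cons words0_def)
  have a1: "fst a = 1 \<Longrightarrow> snd a \<noteq> 1"
    using assms(2) by (cases a) (auto simp: Cons words0_def)
  define f where "f n = harmonic_sum n w" for n
  have f: "f (Suc n) - f n = snd a ^ Suc n / of_nat (Suc n) ^ fst a * harmonic_sum n u" for n
    by (simp add: f_def Cons point_def)
  obtain C where C: "C \<ge> 0" "\<And>n. norm (harmonic_sum n u) \<le> C * sqrt (real n + 1)"
    using harmonic_sum_bound[OF assms(1) u] by blast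
  have sqrt_over: "sqrt x / (x * x) = 1 / (x * sqrt x)" if "x > 0" for x :: real
    using that by (simp add: divide_simps)
  have "\<exists>L C. f \<longlonglongrightarrow> L \<and> (\<forall>n. norm (f n - L) \<le> C / sqrt (real n + 1))"
  proof (cases "fst a = 1")
    case False
    have r: "norm (f (Suc n) - f n) \<le> C / ((real n + 1) * sqrt (real n + 1))" for n
    proof -
      have "norm (f (Suc n) - f n) = norm (harmonic_sum n u) / (real n + 1) ^ fst a"
        by (simp add: f norm_mult norm_divide norm_power a(1) add.commute del: of_nat_Suc)
          (simp add: add.commute)
      also have "\<dots> \<le> (C * sqrt (real n + 1)) / (real n + 1) ^ 2"
        using False a(2) C(1) by (intro frac_le C power_increasing) auto
      also have "\<dots> = C * (sqrt (real n + 1) / ((real n + 1) * (real n + 1)))"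
        by (simp add: power2_eq_square)
      also have "\<dots> = C / ((real n + 1) * sqrt (real n + 1))"
        by (subst sqrt_over) auto
      finally show ?thesis .
    qed
    show ?thesis
      by (rule convergence_sqrt_rate[of f "\<lambda>n. 0" "\<lambda>n. f (Suc n) - f n" 0 C])
        (use r C(1) in auto)
  next
    case True
    define c where "c = 1 / (snd a - 1)"
    have c: "c * snd a - c = 1"
      using a1[OF True] by (simp add: c_def flip: right_diff_distrib_numeral)
        (simp add: diff_divide_distrib[symmetric])
    obtain D where D: "D \<ge> 0"
      "\<And>n. norm (harmonic_sum (Suc n) u - harmonic_sum n u) \<le> D / sqrt (real n + 1)"
      using harmonic_sum_increment[OF assms(1) u] by blast
    define q where "q n = harmonic_sum n u / of_nat (Suc n)" for n
    define g where "g n = c * snd a ^ Suc n * q n" for n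
    define r where "r n = c * snd a ^ Suc (Suc n) * (q n - q (Suc n))" for n
    \<comment> \<open>Abel summation: \<open>snd a ^ Suc n\<close> is the forward difference of \<open>c * snd a ^ Suc n\<close>.\<close>
    have "f (Suc n) - f n = g (Suc n) - g n + r n" for n
    proof -
      have "g (Suc n) - g n + r n = (c * snd a - c) * (snd a ^ Suc n * q n)"
        by (simp add: g_def r_def algebra_simps)
      then show ?thesis by (simp add: c f True q_def)
    qed
    moreover have "norm (g n) \<le> (norm c * C) / sqrt (real n + 1)" for n
    proof -
      have "norm (g n) = norm c * (norm (harmonic_sum n u) / (real n + 1))"
        by (simp add: g_def q_def norm_mult norm_divide norm_power a(1) del: of_nat_Suc)
      also have "\<dots> \<le> norm c * (C * sqrt (real n + 1) / (real n + 1))"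
        by (intro mult_left_mono divide_right_mono C) auto
      also have "\<dots> = (norm c * C) / sqrt (real n + 1)"
        by (simp add: divide_simps)
      finally show ?thesis .
    qed
    moreover have "norm (r n) \<le> (norm c * (C + D)) / ((real n + 1) * sqrt (real n + 1))" for n
    proof -
      define x where "x = real n + 1"
      have x: "x > 0" by (simp add: x_def)
      have cx: "of_nat (Suc n) = complex_of_real x" "of_nat (Suc (Suc n)) = complex_of_real (x + 1)"
        by (simp_all add: x_def)
      have ne: "complex_of_real x \<noteq> 0" "complex_of_real (x + 1) \<noteq> 0"
        using x by (auto simp del: of_real_add)
      \<comment> \<open>The change of the denominator costs a factor
        \<open>1 / (x * (x + 1))\<close>; the change of the numerator is one increment of the inner
        sum, controlled by \<open>D\<close>.\<close>
      have "harmonic_sum n u / of_real x - harmonic_sum (Suc n) u / of_real (x + 1) =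
          harmonic_sum n u * of_real (1 / (x * (x + 1))) -
          (harmonic_sum (Suc n) u - harmonic_sum n u) * of_real (1 / (x + 1))"
        using ne by (simp add: divide_simps) (simp add: algebra_simps)
      also have "norm \<dots> \<le> norm (harmonic_sum n u * of_real (1 / (x * (x + 1)))) +
          norm ((harmonic_sum (Suc n) u - harmonic_sum n u) * of_real (1 / (x + 1)))"
        by (rule norm_triangle_ineq4)
      also have "\<dots> = norm (harmonic_sum n u) * (1 / (x * (x + 1))) +
          norm (harmonic_sum (Suc n) u - harmonic_sum n u) * (1 / (x + 1))"
        unfolding norm_mult norm_of_real using x by simp
      also have "\<dots> \<le> (C * sqrt x) * (1 / (x * x)) + (D / sqrt x) * (1 / x)"
        using C D x unfolding x_def
        by (intro add_mono mult_mono divide_left_mono) auto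
      also have "\<dots> = C * (sqrt x / (x * x)) + D / (x * sqrt x)"
        by simp
      also have "\<dots> = (C + D) / (x * sqrt x)"
        unfolding sqrt_over[OF x] by (simp add: add_divide_distrib)
      finally have "norm c * norm (harmonic_sum n u / of_real x -
          harmonic_sum (Suc n) u / of_real (x + 1)) \<le> norm c * ((C + D) / (x * sqrt x))"
        by (rule mult_left_mono) simp
      then show ?thesis
        unfolding r_def q_def cx norm_mult norm_power a(1) by (simp add: x_def)
    qed
    ultimately show ?thesis
      using convergence_sqrt_rate[of f g r "norm c * C" "norm c * (C + D)"] C(1) D(1)
      by (metis add_nonneg_nonneg mult_nonneg_nonneg norm_ge_zero)
  qed
  then show thesis using that unfolding f_def[abs_def] by blast
qed

subsection \<open>Asymptotic polynomials in the harmonic numbers\<close>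

text \<open>Plain convergence to zero would not survive multiplication by polynomials in
  \<open>harm n\<close>, which occurs when asymptotic expansions are multiplied.\<close>

definition negligible_seq :: "(nat \<Rightarrow> complex) \<Rightarrow> bool" where
  "negligible_seq e \<longleftrightarrow> (\<forall>k. (\<lambda>n. e n * harm n ^ k) \<longlonglongrightarrow> 0)"

lemma negligible_seq_tendsto: "negligible_seq e \<Longrightarrow> e \<longlonglongrightarrow> 0"
  unfolding negligible_seq_def by (drule spec[of _ 0]) simp

lemma negligible_seq_zero [simp]: "negligible_seq (\<lambda>n. 0)"
  by (simp add: negligible_seq_def)

lemma negligible_seq_add:
  "negligible_seq d \<Longrightarrow> negligible_seq e \<Longrightarrow> negligible_seq (\<lambda>n. d n + e n)"
  unfolding negligible_seq_def by (auto simp: distrib_right intro: tendsto_add_zero)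

lemma negligible_seq_cmult: "negligible_seq e \<Longrightarrow> negligible_seq (\<lambda>n. c * e n)"
  unfolding negligible_seq_def by (auto simp: mult.assoc intro: tendsto_mult_right_zero)

lemma negligible_seq_mult:
  assumes "negligible_seq d" "negligible_seq e"
  shows "negligible_seq (\<lambda>n. d n * e n)"
  unfolding negligible_seq_def
proof
  fix k
  have "(\<lambda>n. d n * (e n * harm n ^ k)) \<longlonglongrightarrow> 0"
    by (rule tendsto_mult_zero[OF negligible_seq_tendsto[OF assms(1)]])
      (use assms(2) in \<open>simp add: negligible_seq_def\<close>)
  then show "(\<lambda>n. d n * e n * harm n ^ k) \<longlonglongrightarrow> 0" by (simp add: mult.assoc)
qed

lemma negligible_seq_harm:
  assumes "negligible_seq e"
  shows "negligible_seq (\<lambda>n. harm n * e n)"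
  unfolding negligible_seq_def
proof
  fix k
  have "(\<lambda>n. e n * harm n ^ Suc k) \<longlonglongrightarrow> 0"
    using assms unfolding negligible_seq_def by blast
  then show "(\<lambda>n. harm n * e n * harm n ^ k) \<longlonglongrightarrow> 0" by (simp add: mult_ac)
qed

lemma negligible_seq_poly:
  assumes "negligible_seq e"
  shows "negligible_seq (\<lambda>n. poly P (harm n) * e n)"
proof (induction P)
  case (pCons c P)
  have "negligible_seq (\<lambda>n. c * e n + harm n * (poly P (harm n) * e n))"
    by (intro negligible_seq_add negligible_seq_cmult negligible_seq_harm assms pCons.IH)
  then show ?case by (simp add: algebra_simps)
qed simp

lemma negligible_seqI:
  assumes "\<And>n. norm (e n) \<le> C / sqrt (real n + 1)"
  shows "negligible_seq e"
  unfolding negligible_seq_def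
proof
  fix k
  show "(\<lambda>n. e n * harm n ^ k) \<longlonglongrightarrow> 0"
  proof (rule Lim_null_comparison)
    show "eventually (\<lambda>n. norm (e n * harm n ^ k) \<le> C * (harm n ^ k / sqrt (real n + 1))) sequentially"
    proof (intro always_eventually allI)
      fix n
      show "norm (e n * harm n ^ k) \<le> C * (harm n ^ k / sqrt (real n + 1))"
        using mult_right_mono[OF assms[of n], of "harm n ^ k"]
        by (simp add: norm_mult norm_power norm_harm harm_nonneg)
    qed
    show "(\<lambda>n. C * (harm n ^ k / sqrt (real n + 1))) \<longlonglongrightarrow> 0"
      using tendsto_mult_right_zero[OF harm_power_over_sqrt] .
  qed
qed

definition asymptotic_poly :: "(nat \<Rightarrow> complex) \<Rightarrow> complex poly \<Rightarrow> bool" where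
  "asymptotic_poly f P \<longleftrightarrow> negligible_seq (\<lambda>n. f n - poly P (harm n))"

lemma asymptotic_poly_add:
  assumes "asymptotic_poly f P" "asymptotic_poly g Q"
  shows "asymptotic_poly (\<lambda>n. f n + g n) (P + Q)"
  using negligible_seq_add[OF assms[unfolded asymptotic_poly_def]]
  by (simp add: asymptotic_poly_def algebra_simps)

lemma asymptotic_poly_cmult:
  "asymptotic_poly f P \<Longrightarrow> asymptotic_poly (\<lambda>n. c * f n) (smult c P)"
  unfolding asymptotic_poly_def by (drule negligible_seq_cmult[of _ c]) (simp add: algebra_simps)

lemma asymptotic_poly_const: "asymptotic_poly (\<lambda>n. c) [:c:]"
  by (simp add: asymptotic_poly_def)

lemma asymptotic_poly_sum:
  "(\<And>i. i \<in> I \<Longrightarrow> asymptotic_poly (f i) (P i)) \<Longrightarrow>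
     asymptotic_poly (\<lambda>n. \<Sum>i\<in>I. f i n) (\<Sum>i\<in>I. P i)"
  by (induction I rule: infinite_finite_induct)
    (auto intro: asymptotic_poly_add simp: asymptotic_poly_const[of 0, simplified])

text \<open>With \<open>f = P + d\<close> and \<open>g = Q + e\<close> the error of the product is
  \<open>d * e + P * e + Q * d\<close>.\<close>

lemma asymptotic_poly_mult:
  assumes "asymptotic_poly f P" "asymptotic_poly g Q"
  shows "asymptotic_poly (\<lambda>n. f n * g n) (P * Q)"
proof -
  let ?d = "\<lambda>n. f n - poly P (harm n)" and ?e = "\<lambda>n. g n - poly Q (harm n)"
  have "negligible_seq (\<lambda>n. (?d n * ?e n + poly P (harm n) * ?e n) + poly Q (harm n) * ?d n)"
    using assms unfolding asymptotic_poly_def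
    by (intro negligible_seq_add negligible_seq_mult negligible_seq_poly)
  then show ?thesis by (simp add: asymptotic_poly_def algebra_simps)
qed

text \<open>As \<open>harm n\<close> tends to infinity, a nonconstant polynomial evaluated there
  stays away from zero, and a constant with limit zero is zero.\<close>

lemma asymptotic_poly_unique:
  assumes "asymptotic_poly f P" "asymptotic_poly f Q"
  shows "P = Q"
proof (rule ccontr)
  assume "P \<noteq> Q"
  \<comment> \<open>\<open>R\<close> is zero exactly when the difference is constant.\<close>
  obtain c R where R: "Q - P = pCons c R" by (cases "Q - P")
  have "asymptotic_poly (\<lambda>n. f n + (-1) * f n) (Q + smult (-1) P)"
    by (intro asymptotic_poly_add asymptotic_poly_cmult assms)
  then have lim: "(\<lambda>n. poly (Q - P) (harm n)) \<longlonglongrightarrow> 0"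
    unfolding asymptotic_poly_def using tendsto_minus negligible_seq_tendsto by fastforce
  show False
  proof (cases "R = 0")
    case True
    then show False using lim R \<open>P \<noteq> Q\<close> by (simp add: LIMSEQ_const_iff)
  next
    case False
    then obtain r where r: "\<And>z. r \<le> norm z \<Longrightarrow> 1 \<le> norm (poly (Q - P) z)"
      using poly_infinity[OF False, of 1 c] R by auto
    have "eventually (\<lambda>n. r \<le> (harm n :: real)) sequentially"
      using harm_at_top by (simp add: filterlim_at_top)
    then have "eventually (\<lambda>n. 1 \<le> norm (poly (Q - P) (harm n))) sequentially"
      by eventually_elim (rule r, simp add: norm_harm)
    moreover have "eventually (\<lambda>n. norm (poly (Q - P) (harm n)) < 1) sequentially"
      using tendsto_norm_zero[OF lim] by (rule order_tendstoD) simp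
    ultimately have "eventually (\<lambda>n::nat. False) sequentially"
      by eventually_elim simp
    then show False by simp
  qed
qed

lemma asymptotic_poly_words0:
  assumes "N \<ge> 1" "w \<in> words0 N"
  shows "asymptotic_poly (\<lambda>n. harmonic_sum n w) [:cmzv w:]"
proof -
  obtain L C where L: "(\<lambda>n. harmonic_sum n w) \<longlonglongrightarrow> L"
    "\<And>n. norm (harmonic_sum n w - L) \<le> C / sqrt (real n + 1)"
    using harmonic_sum_admissible[OF assms] by blast
  have "cmzv w = L"
    unfolding cmzv_def cmzv_partial_eq by (rule limI[OF L(1)])
  with L(2) show ?thesis
    by (auto simp: asymptotic_poly_def intro: negligible_seqI)
qed

text \<open>The product of \<open>harm n\<close> with the sum for \<open>u\<close> expands by the
  stuffle rule. Solving for the term of \<open>(1, 1) # u\<close> expresses it through sequences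
  whose expansions are known by induction.\<close>

lemma asymptotic_poly_exists:
  assumes "N \<ge> 1" "w \<in> words1 N"
  shows "\<exists>P. asymptotic_poly (\<lambda>n. harmonic_sum n w) P"
  using assms(2)
proof (induction w rule: words1_induct)
  case (words0 w)
  then show ?case using asymptotic_poly_words0[OF assms(1)] by blast
next
  case (one u)
  define x where "x = stuffle_word [(1, 1)] u"
  define c :: complex where "c = of_rat (Poly_Mapping.lookup x ((1, 1) # u))"
  define K where "K = Poly_Mapping.keys x - {(1, 1) # u}"
  have c: "c \<noteq> 0"
    using lookup_stuffle_one_pos[of u] by (simp add: c_def x_def del: One_nat_def)
  have "\<forall>v\<in>K. \<exists>P. asymptotic_poly (\<lambda>n. harmonic_sum n v) P"
    using one.IH(2) by (simp add: K_def x_def del: One_nat_def)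
  then obtain P where P: "\<And>v. v \<in> K \<Longrightarrow> asymptotic_poly (\<lambda>n. harmonic_sum n v) (P v)"
    by metis
  obtain Q where Q: "asymptotic_poly (\<lambda>n. harmonic_sum n u) Q"
    using one.IH(1) by blast
  have harm: "asymptotic_poly harm [:0, 1:]"
    by (simp add: asymptotic_poly_def)
  have "harmonic_sum n ((1, 1) # u) = inverse c * (harm n * harmonic_sum n u +
      (-1) * (\<Sum>v\<in>K. of_rat (Poly_Mapping.lookup x v) * harmonic_sum n v))" for n
    using harmonic_sum_stuffle[of n "[(1, 1)]" u, unfolded lin_stuffle_one harmonic_sum_one] c
    by (simp add: c_def K_def x_def field_simps del: One_nat_def)
  moreover have "asymptotic_poly (\<lambda>n. inverse c * (harm n * harmonic_sum n u +
      (-1) * (\<Sum>v\<in>K. of_rat (Poly_Mapping.lookup x v) * harmonic_sum n v)))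
    (smult (inverse c) ([:0, 1:] * Q +
      smult (-1) (\<Sum>v\<in>K. smult (of_rat (Poly_Mapping.lookup x v)) (P v))))"
    by (intro asymptotic_poly_cmult asymptotic_poly_add asymptotic_poly_mult asymptotic_poly_sum
        P Q harm)
  ultimately show ?case by auto
qed

lemma poly_eqI_eval:
  fixes p q :: "complex poly"
  shows "(\<And>T. poly p T = poly q T) \<Longrightarrow> p = q"
  by (simp add: fun_eq_iff flip: poly_eq_poly_eq_iff)

subsection \<open>Regularization\<close>

text \<open>The regularization is obtained analytically, from the expansion of the truncated sums;
  its algebraic characterization is derived from this.\<close>

definition reg_word :: "letter list \<Rightarrow> complex poly" where
  "reg_word w = (THE P. asymptotic_poly (\<lambda>n. harmonic_sum n w) P)"

definition reg :: "ncpoly \<Rightarrow> complex poly" where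
  "reg x = (\<Sum>w \<in> Poly_Mapping.keys x. smult (of_rat (Poly_Mapping.lookup x w)) (reg_word w))"

lemma reg_word_eqI: "asymptotic_poly (\<lambda>n. harmonic_sum n w) P \<Longrightarrow> reg_word w = P"
  unfolding reg_word_def by (rule the_equality) (auto intro: asymptotic_poly_unique)

lemma asymptotic_reg_word:
  "N \<ge> 1 \<Longrightarrow> w \<in> words1 N \<Longrightarrow> asymptotic_poly (\<lambda>n. harmonic_sum n w) (reg_word w)"
  using asymptotic_poly_exists reg_word_eqI by metis

lemma poly_reg: "poly (reg x) T = lin (\<lambda>w. poly (reg_word w) T) x"
  by (simp add: reg_def lin_def poly_sum)

lemma reg_of_word [simp]: "reg (of_word w) = reg_word w"
  by (simp add: reg_def)

lemma asymptotic_reg: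
  assumes "N \<ge> 1" "x \<in> alg1 N"
  shows "asymptotic_poly (\<lambda>n. lin (harmonic_sum n) x) (reg x)"
  unfolding lin_def reg_def using assms
  by (intro asymptotic_poly_sum asymptotic_poly_cmult asymptotic_reg_word)
    (auto simp: alg1_def)

lemma reg_word_Nil: "reg_word [] = 1"
  by (rule reg_word_eqI) (simp add: asymptotic_poly_def)

lemma reg_word_one: "reg_word [(1, 1)] = [:0, 1:]"
  by (rule reg_word_eqI) (simp add: asymptotic_poly_def harmonic_sum_one del: One_nat_def)

lemma of_word_alg1: "w \<in> words1 N \<Longrightarrow> of_word w \<in> alg1 N"
  by (simp add: alg1_def)

lemma stuffle_word_alg1: "u \<in> words1 N \<Longrightarrow> v \<in> words1 N \<Longrightarrow> stuffle_word u v \<in> alg1 N"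
  using keys_stuffle_word by (auto simp: alg1_def)

text \<open>Truncated sums are multiplicative, so both sides are expansions of one and the same
  sequence.\<close>

lemma reg_stuffle_word:
  assumes "N \<ge> 1" "u \<in> words1 N" "v \<in> words1 N"
  shows "reg (stuffle_word u v) = reg_word u * reg_word v"
proof (rule asymptotic_poly_unique)
  show "asymptotic_poly (\<lambda>n. harmonic_sum n u * harmonic_sum n v) (reg (stuffle_word u v))"
    using asymptotic_reg[OF assms(1) stuffle_word_alg1[OF assms(2,3)]]
    by (simp add: harmonic_sum_stuffle)
  show "asymptotic_poly (\<lambda>n. harmonic_sum n u * harmonic_sum n v) (reg_word u * reg_word v)"
    using assms by (intro asymptotic_poly_mult asymptotic_reg_word)
qed

lemma lin_reg_stuffle_word:
  assumes "N \<ge> 1" "u \<in> words1 N" "v \<in> words1 N"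
  shows "lin (\<lambda>w. poly (reg_word w) T) (stuffle_word u v) = poly (reg_word u) T * poly (reg_word v) T"
  using reg_stuffle_word[OF assms] by (simp flip: poly_reg)

lemma is_regularization_reg:
  assumes "N \<ge> 1"
  shows "is_regularization N reg"
  unfolding is_regularization_def stuffle_alg_hom_def
proof (intro conjI ballI allI)
  fix x y assume "x \<in> alg1 N" "y \<in> alg1 N"
  then show "reg (stuffle x y) = reg x * reg y"
    by (intro poly_eqI_eval) (simp add: poly_reg lin_stuffle[OF lin_reg_stuffle_word[OF assms]])
next
  fix w assume "w \<in> words0 N"
  then show "reg (of_word w) = [:cmzv w:]"
    using asymptotic_poly_words0[OF assms] by (simp add: reg_word_eqI)
qed (auto intro!: poly_eqI_eval simp: poly_reg lin_add lin_scale reg_word_Nil reg_word_one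
    simp del: One_nat_def)

text \<open>At a fixed \<open>T\<close> the difference of two regularizations vanishes on
  \<open>words0 N\<close>, and stuffling with \<open>(1, 1)\<close> multiplies it by
  \<open>T\<close>.\<close>

lemma regularization_unique:
  assumes N: "N \<ge> 1" and Z: "is_regularization N Z" and w: "w \<in> words1 N"
  shows "Z (of_word w) = reg_word w"
proof (rule poly_eqI_eval)
  fix T
  have hom: "\<And>x y. x \<in> alg1 N \<Longrightarrow> y \<in> alg1 N \<Longrightarrow> Z (x + y) = Z x + Z y"
    "\<And>c x. x \<in> alg1 N \<Longrightarrow> Z (scale c x) = smult (of_rat c) (Z x)"
    "\<And>x y. x \<in> alg1 N \<Longrightarrow> y \<in> alg1 N \<Longrightarrow> Z (stuffle x y) = Z x * Z y"
    "\<And>w. w \<in> words0 N \<Longrightarrow> Z (of_word w) = [:cmzv w:]" "Z (of_word [(1, 1)]) = [:0, 1:]"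
    using Z by (auto simp: is_regularization_def stuffle_alg_hom_def)
  \<comment> \<open>Additivity of \<open>Z\<close> is given on \<open>alg1 N\<close> only, so
    \<open>x\<close> is assembled word by word with all partial sums kept in
    \<open>alg1 N\<close>.\<close>
  have Z_lin: "poly (Z x) T = lin (\<lambda>w. poly (Z (of_word w)) T) x" if x: "x \<in> alg1 N" for x
  proof -
    have 0: "0 \<in> alg1 N" by (simp add: alg1_def)
    have "scale 0 0 = (0 :: ncpoly)"
      by (rule poly_mapping_eqI) (simp add: lookup_scale)
    with hom(2)[OF 0, of 0] have Z0: "Z 0 = 0" by simp
    define g where "g w = scale (Poly_Mapping.lookup x w) (of_word w)" for w
    have "(\<Sum>w\<in>K. g w) \<in> alg1 N \<and> poly (Z (\<Sum>w\<in>K. g w)) T =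
        (\<Sum>w\<in>K. of_rat (Poly_Mapping.lookup x w) * poly (Z (of_word w)) T)"
      if "finite K" "K \<subseteq> words1 N" for K
      using that
    proof (induction K rule: finite_induct)
      case (insert w K)
      have "w \<in> words1 N" using insert.prems by simp
      then have gw: "g w \<in> alg1 N"
        using keys_scale[of "Poly_Mapping.lookup x w" "of_word w"]
        by (auto simp: alg1_def g_def)
      have "g w + (\<Sum>w\<in>K. g w) \<in> alg1 N"
        using insert gw Poly_Mapping.keys_add[of "g w" "\<Sum>w\<in>K. g w"] by (auto simp: alg1_def)
      moreover have "Z (g w) = smult (of_rat (Poly_Mapping.lookup x w)) (Z (of_word w))"
        unfolding g_def by (rule hom(2)) (use insert in \<open>auto intro: of_word_alg1\<close>)
      ultimately show ?case using insert gw hom(1) by simp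
    qed (simp add: 0 Z0)
    from this[of "Poly_Mapping.keys x"] x
    have "poly (Z (\<Sum>w\<in>Poly_Mapping.keys x. g w)) T = lin (\<lambda>w. poly (Z (of_word w)) T) x"
      by (simp add: alg1_def lin_def)
    moreover have "(\<Sum>w\<in>Poly_Mapping.keys x. g w) = x"
      by (rule poly_mapping_eqI)
        (simp add: g_def lookup_sum lookup_scale lookup_single when_def in_keys_iff if_distrib cong: if_cong)
    ultimately show ?thesis by simp
  qed
  let ?e = "\<lambda>w. poly (Z (of_word w)) T - poly (reg_word w) T"
  have "?e w = 0"
  proof (rule vanishing_on_words1[OF w, where T = T])
    fix w assume "w \<in> words0 N"
    then show "?e w = 0"
      using hom(4) reg_word_eqI[OF asymptotic_poly_words0[OF N]] by simp
  next
    fix u assume u: "u \<in> words1 N"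
    have one: "[(1, 1)] \<in> words1 N" by simp
    have "lin (\<lambda>w. poly (Z (of_word w)) T) (stuffle_word [(1, 1)] u) = T * poly (Z (of_word u)) T"
      using hom(3)[OF of_word_alg1[OF one] of_word_alg1[OF u], unfolded stuffle_of_word hom(5)]
        Z_lin[OF stuffle_word_alg1[OF one u]] by simp
    moreover have "lin (\<lambda>w. poly (reg_word w) T) (stuffle_word [(1, 1)] u) = T * poly (reg_word u) T"
      using lin_reg_stuffle_word[OF N one u, of T] by (simp only: reg_word_one) simp
    ultimately show "lin ?e (stuffle_word [(1, 1)] u) = T * ?e u"
      by (simp add: lin_diff_fun right_diff_distrib)
  qed
  then show "poly (Z (of_word w)) T = poly (reg_word w) T" by simp
qed

text \<open>Existence makes the choice meaningful, and uniqueness makes it irrelevant on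
  \<open>words1 N\<close>.\<close>

lemma zeta_star_eq: "N \<ge> 1 \<Longrightarrow> w \<in> words1 N \<Longrightarrow> zeta_star N w = reg_word w"
  unfolding zeta_star_def
  by (rule regularization_unique[OF _ someI[of "is_regularization N", OF is_regularization_reg]])

section \<open>The derivative in \<open>T\<close> of regularized values\<close>

text \<open>On regularized values this operation realizes \<open>d/dT\<close>.\<close>

definition drop_one :: "(letter list \<Rightarrow> complex) \<Rightarrow> letter list \<Rightarrow> complex" where
  "drop_one f w = (case w of [] \<Rightarrow> 0 | a # u \<Rightarrow> if a = (1, 1) then f u else 0)"

lemma drop_one_Cons [simp]: "drop_one f (a # u) = (if a = (1, 1) then f u else 0)"
  by (simp add: drop_one_def)

text \<open>The Leibniz rule for a product with the letter \<open>(1, 1)\<close>. Merging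
  \<open>(1, 1)\<close> with the first letter of \<open>u\<close> gives weight at least 2, so that
  word is killed.\<close>

lemma drop_one_stuffle:
  assumes "u \<in> words1 N"
  shows "lin (drop_one f) (stuffle_word [(1, 1)] u) =
    f u + drop_one (\<lambda>v. lin f (stuffle_word [(1, 1)] v)) u"
proof (cases u)
  case (Cons a v)
  then show ?thesis
    using assms unfolding Cons stuffle_word_one_Cons lin_add lin_prepend
    by (cases a) (auto simp del: stuffle_word.simps)
qed (simp add: drop_one_def)

lemma pderiv_sum: "pderiv (\<Sum>i\<in>I. p i) = (\<Sum>i\<in>I. pderiv (p i))"
  using higher_pderiv_sum[of 1 p I] by simp

text \<open>Both sides are derivations of the stuffle product along \<open>\<lambda>w. poly (reg_word w) T\<close>,
  and they agree on the generators.\<close>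

lemma pderiv_reg_word:
  assumes N: "N \<ge> 1" and w: "w \<in> words1 N"
  shows "poly (pderiv (reg_word w)) T = drop_one (\<lambda>v. poly (reg_word v) T) w"
proof -
  let ?f = "\<lambda>v. poly (reg_word v) T" and ?d = "\<lambda>v. poly (pderiv (reg_word v)) T"
  have one: "[(1, 1)] \<in> words1 N" by simp
  have "?d w - drop_one ?f w = 0"
  proof (rule vanishing_on_words1[OF w, where T = T])
    fix w assume "w \<in> words0 N"
    then show "?d w - drop_one ?f w = 0"
      using reg_word_eqI[OF asymptotic_poly_words0[OF N]]
      by (cases w) (auto simp: drop_one_def words0_def pderiv_pCons split: if_splits)
  next
    fix u assume u: "u \<in> words1 N"
    have "lin ?d x = poly (pderiv (reg x)) T" for x
      by (simp add: reg_def lin_def pderiv_sum pderiv_smult poly_sum)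
    then have "lin ?d (stuffle_word [(1, 1)] u) = ?f u + T * ?d u"
      using reg_stuffle_word[OF N one u] unfolding reg_word_one
      by (simp add: pderiv_mult pderiv_pCons)
    moreover have "lin (drop_one ?f) (stuffle_word [(1, 1)] u) = ?f u + T * drop_one ?f u"
    proof -
      have "lin ?f (stuffle_word [(1, 1)] v) = T * ?f v" if "v \<in> words1 N" for v
        using lin_reg_stuffle_word[OF N one that, of T] by (simp only: reg_word_one) simp
      then have "drop_one (\<lambda>v. lin ?f (stuffle_word [(1, 1)] v)) u = T * drop_one ?f u"
        using u by (cases u) (auto simp: drop_one_def)
      then show ?thesis unfolding drop_one_stuffle[OF u] by simp
    qed
    \<comment> \<open>The inhomogeneous terms \<open>?f u\<close> of the two Leibniz rules cancel in
      the difference.\<close>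
    ultimately show "lin (\<lambda>w. ?d w - drop_one ?f w) (stuffle_word [(1, 1)] u) =
        T * (?d u - drop_one ?f u)"
      by (simp add: lin_diff_fun right_diff_distrib)
  qed
  then show ?thesis by simp
qed

subsection \<open>Symmetrized values\<close>

definition sym_coeff :: "letter list \<Rightarrow> complex" where
  "sym_coeff w = (- 1) ^ (\<Sum>(s, \<eta>) \<leftarrow> w. s) * (\<Prod>(s, \<eta>) \<leftarrow> w. cnj \<eta>)"

definition conj_word :: "letter list \<Rightarrow> letter list" where
  "conj_word w = map (\<lambda>(s, \<eta>). (s, cnj \<eta>)) w"

lemma conj_word_words1: "w \<in> words1 N \<Longrightarrow> conj_word w \<in> words1 N"
  by (auto simp: conj_word_def words1_def simp flip: complex_cnj_power)

lemma rev_words1: "w \<in> words1 N \<Longrightarrow> rev w \<in> words1 N"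
  by (simp add: words1_def)

lemma take_words1: "w \<in> words1 N \<Longrightarrow> take j w \<in> words1 N"
  by (auto simp: words1_def dest: in_set_takeD)

lemma drop_words1: "w \<in> words1 N \<Longrightarrow> drop j w \<in> words1 N"
  by (auto simp: words1_def dest: in_set_dropD)

lemma sym_coeff_Cons [simp]:
  "sym_coeff (a # w) = ((- 1) ^ fst a * cnj (snd a)) * sym_coeff w"
  by (simp add: sym_coeff_def power_add case_prod_beta)

lemma sym_coeff_snoc: "sym_coeff (w @ [a]) = sym_coeff w * ((- 1) ^ fst a * cnj (snd a))"
  by (simp add: sym_coeff_def power_add case_prod_beta)

lemma zeta_sym_poly_eq:
  assumes "N \<ge> 1" "w \<in> words1 N"
  shows "zeta_sym_poly N w = (\<Sum>j\<le>length w. smult (sym_coeff (take j w))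
    (reg_word (rev (conj_word (take j w))) * reg_word (drop j w)))"
  unfolding zeta_sym_poly_def
  using assms
  by (intro sum.cong)
    (simp_all add: zeta_star_eq rev_words1 take_words1 drop_words1 conj_word_words1 sym_coeff_def
      flip: conj_word_def)

text \<open>A letter \<open>(1, 1)\<close> at position \<open>j\<close> is removed from the reversed
  left factor at the cut \<open>Suc j\<close> and from the right factor at the cut \<open>j\<close>.
  Its weight 1 gives these two terms opposite signs.\<close>

lemma pderiv_zeta_sym_poly:
  assumes N: "N \<ge> 1" and w: "w \<in> words1 N"
  shows "pderiv (zeta_sym_poly N w) = 0"
proof (rule poly_eqI_eval)
  fix T
  let ?f = "\<lambda>v. poly (reg_word v) T"
  let ?l = "\<lambda>j. sym_coeff (take j w) * drop_one ?f (rev (conj_word (take j w))) * ?f (drop j w)"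
  let ?r = "\<lambda>j. sym_coeff (take j w) * ?f (rev (conj_word (take j w))) * drop_one ?f (drop j w)"
  have "poly (pderiv (zeta_sym_poly N w)) T = (\<Sum>j\<le>length w. ?l j + ?r j)"
    unfolding zeta_sym_poly_eq[OF N w] pderiv_sum poly_sum
    using pderiv_reg_word[OF N] w
    by (intro sum.cong) (simp_all add: pderiv_smult pderiv_mult rev_words1 take_words1 drop_words1
        conj_word_words1 algebra_simps)
  also have "\<dots> = (\<Sum>j\<le>length w. ?l j) + (\<Sum>j\<le>length w. ?r j)"
    by (rule sum.distrib)
  \<comment> \<open>The left factor is empty at the cut 0, and the right one at the cut
    \<open>length w\<close>; these two boundary terms vanish, and the index shift pairs the
    others.\<close>
  also have "(\<Sum>j\<le>length w. ?l j) = (\<Sum>j<length w. ?l (Suc j))"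
    by (simp add: sum.atMost_shift drop_one_def conj_word_def)
  also have "(\<Sum>j\<le>length w. ?r j) = (\<Sum>j<length w. ?r j)"
    by (simp add: drop_one_def flip: lessThan_Suc_atMost)
  also have "(\<Sum>j<length w. ?l (Suc j)) + (\<Sum>j<length w. ?r j) = (\<Sum>j<length w. ?l (Suc j) + ?r j)"
    by (rule sum.distrib[symmetric])
  also have "\<dots> = 0"
  proof (rule sum.neutral, rule ballI)
    fix j assume "j \<in> {..<length w}"
    then have j: "j < length w" by simp
    have cnj1: "cnj z = 1 \<longleftrightarrow> z = 1" for z
      by (metis complex_cnj_cnj complex_cnj_one)
    obtain s \<eta> where a: "w ! j = (s, \<eta>)" by fastforce
    have l: "drop_one ?f (rev (conj_word (take (Suc j) w))) =
        (if w ! j = (1, 1) then ?f (rev (conj_word (take j w))) else 0)"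
      by (simp add: take_Suc_conv_app_nth[OF j] conj_word_def drop_one_def a cnj1)
    have r: "drop_one ?f (drop j w) = (if w ! j = (1, 1) then ?f (drop (Suc j) w) else 0)"
      by (simp add: drop_one_def flip: Cons_nth_drop_Suc[OF j])
    show "?l (Suc j) + ?r j = 0"
      unfolding l r by (simp add: take_Suc_conv_app_nth[OF j] sym_coeff_snoc)
  qed
  finally show "poly (pderiv (zeta_sym_poly N w)) T = poly 0 T" by simp
qed

text \<open>A complex polynomial with zero derivative has degree zero, so the description in
  \<open>zeta_sym_word\<close> denotes its constant value.\<close>

lemma zeta_sym_poly_const:
  assumes "N \<ge> 1" "w \<in> words1 N"
  shows "zeta_sym_poly N w = [:zeta_sym_word N w:]"
proof -
  obtain c where c: "zeta_sym_poly N w = [:c:]"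
    using pderiv_zeta_sym_poly[OF assms] unfolding pderiv_eq_0_iff by (rule degree_eq_zeroE)
  then show ?thesis by (simp add: zeta_sym_word_def)
qed

section \<open>Truncated symmetrized sums\<close>

text \<open>For the letter \<open>(s, \<eta>)\<close> and positive \<open>k\<close> this is
  \<open>cnj \<eta> ^ (k + 1) / (- k) ^ s\<close>, again multiplicative in the letter.\<close>

definition neg_point :: "nat \<Rightarrow> letter \<Rightarrow> complex" where
  "neg_point k a = (- 1) ^ fst a * cnj (snd a) * point k (fst a, cnj (snd a))"

definition sym_sum :: "nat \<Rightarrow> letter list \<Rightarrow> complex" where
  "sym_sum n = nested (map neg_point [1..<Suc n] @ rev (map point [1..<Suc n]))"

lemma neg_point_mult: "neg_point k (m + n, \<mu> * \<nu>) = neg_point k (m, \<mu>) * neg_point k (n, \<nu>)"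
  by (simp add: neg_point_def point_mult power_add)

lemma sym_sum_stuffle: "lin (sym_sum n) (stuffle_word u v) = sym_sum n u * sym_sum n v"
  unfolding sym_sum_def by (rule nested_stuffle) (auto simp: point_mult neg_point_mult)

lemma nested_neg_point:
  "nested (map neg_point ks) w = sym_coeff w * nested (map point ks) (conj_word w)"
proof (induction ks arbitrary: w)
  case Nil
  then show ?case by (simp add: nested_no_points conj_word_def sym_coeff_def)
next
  case (Cons k ks)
  show ?case
  proof (cases w)
    case Nil
    then show ?thesis by (simp add: conj_word_def sym_coeff_def)
  next
    case C: (Cons a u)
    show ?thesis
      using Cons.IH[of u] Cons.IH[of w]
      by (simp add: C conj_word_def neg_point_def case_prod_beta algebra_simps)
  qed
qed

text \<open>Each chain is cut between the negative and the positive points. On the negative side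
  \<open>k\<close> increases along the chain, so that part is a harmonic sum of the reversed
  word.\<close>

lemma sym_sum_eq:
  "sym_sum n w = (\<Sum>j\<le>length w. sym_coeff (take j w) *
     (harmonic_sum n (rev (conj_word (take j w))) * harmonic_sum n (drop j w)))"
  unfolding sym_sum_def nested_append nested_neg_point harmonic_sum_def nested_rev
  by (simp add: mult.assoc)

text \<open>Expanding termwise gives the asymptotic polynomial \<open>zeta_sym_poly N w\<close>. As
  it is constant, the expansion amounts to convergence.\<close>

lemma sym_sum_tendsto:
  assumes "N \<ge> 1" "w \<in> words1 N"
  shows "(\<lambda>n. sym_sum n w) \<longlonglongrightarrow> zeta_sym_word N w"
proof -
  have "asymptotic_poly (\<lambda>n. sym_sum n w) (zeta_sym_poly N w)"
    unfolding sym_sum_eq zeta_sym_poly_eq[OF assms] using assms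
    by (intro asymptotic_poly_sum asymptotic_poly_cmult asymptotic_poly_mult asymptotic_reg_word)
      (auto intro: rev_words1 take_words1 drop_words1 conj_word_words1)
  then have "(\<lambda>n. sym_sum n w - zeta_sym_word N w) \<longlonglongrightarrow> 0"
    using negligible_seq_tendsto
    by (fastforce simp: asymptotic_poly_def zeta_sym_poly_const[OF assms])
  then show ?thesis by (simp add: Lim_null[symmetric])
qed

lemma zeta_sym_eq_lin: "zeta_sym N = lin (zeta_sym_word N)"
  by (simp add: fun_eq_iff zeta_sym_def lin_def)

theorem theorem4p7:
  fixes N :: nat
  assumes "N \<ge> 1"
  shows "stuffle_alg_hom N (\<lambda>c z. of_rat c * z) (zeta_sym N)"
proof -
  have hom: "lin (zeta_sym_word N) (stuffle_word u v) = zeta_sym_word N u * zeta_sym_word N v"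
    if u: "u \<in> words1 N" and v: "v \<in> words1 N" for u v
  proof (rule LIMSEQ_unique)
    \<comment> \<open>The product is a fixed finite combination of words, so the limit may be taken
      term by term.\<close>
    show "(\<lambda>n. lin (sym_sum n) (stuffle_word u v)) \<longlonglongrightarrow> lin (zeta_sym_word N) (stuffle_word u v)"
      unfolding lin_def using keys_stuffle_word[OF u v]
      by (intro tendsto_intros sym_sum_tendsto assms) auto
    show "(\<lambda>n. lin (sym_sum n) (stuffle_word u v)) \<longlonglongrightarrow> zeta_sym_word N u * zeta_sym_word N v"
      unfolding sym_sum_stuffle by (intro tendsto_mult sym_sum_tendsto assms u v)
  qed
  \<comment> \<open>The truncations at the empty word are constantly 1, which yields the
    unit.\<close>
  have "(\<lambda>n. sym_sum n []) \<longlonglongrightarrow> 1"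
    by (simp add: sym_sum_def)
  then have "zeta_sym_word N [] = 1"
    using LIMSEQ_unique sym_sum_tendsto[OF assms, of "[]"] by simp
  then show ?thesis
    by (auto simp: stuffle_alg_hom_def zeta_sym_eq_lin lin_add lin_scale lin_stuffle[OF hom])
qed

end
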